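(* (Modified Kirchhoff model, hyperbolicity.) Let $\lambda,\mu,\rho_0>0$, put $\alpha=\lambda/\mu$, and for $\Gamma>-1$ let $$P(\Gamma)=\frac1{\rho_0}\Big(\mu(1+\Gamma)^3-\mu(1+\Gamma)+\lambda\frac{\ln(1+\Gamma)}{1+\Gamma}\Big).$$ The equation in the unknown $a>0$ $$6(5+4\ln 6)\,a=1+12a\ln\!\big(3+3\sqrt{1+12a}\big)+\sqrt{1+12a}$$ has two positive solutions $\alpha_1<\alpha_2$, and if $\alpha_1<\alpha<\alpha_2$ then $P'(\Gamma)>0$ for all $\Gamma>-1$, i.e. the p-system is hyperbolic for all $\Gamma>-1$.
   Context: The p-system is $V_t-(P(\Gamma))_X=0$, $\Gamma_t-V_X=0$ with $\Gamma>-1$; it is (strictly) hyperbolic where $P'(\Gamma)>0$. *)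

theory Defs
  imports "HOL-Analysis.Analysis"
begin

text \<open>
  A system of conservation laws \<open>U\<^sub>t + (F U)\<^sub>X = 0\<close> in \<open>n\<close> unknowns is strictly hyperbolic at
  the state \<open>U\<close> if the Jacobian matrix of the flux \<open>F\<close> has \<open>n\<close> distinct real eigenvalues there.
\<close>

definition real_eigenvalues :: "real ^ 'n ^ 'n \<Rightarrow> real set" where
  "real_eigenvalues A = {c. \<exists>v. v \<noteq> 0 \<and> A *v v = c *s v}"

definition strictly_hyperbolic_at :: "(real ^ 'n \<Rightarrow> real ^ 'n) \<Rightarrow> real ^ 'n \<Rightarrow> bool" where
  "strictly_hyperbolic_at F U \<longleftrightarrow>
     F differentiable (at U) \<and> card (real_eigenvalues (jacobian F (at U))) = CARD('n)"

text \<open>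
  The p-system \<open>V\<^sub>t - (P \<Gamma>)\<^sub>X = 0\<close>, \<open>\<Gamma>\<^sub>t - V\<^sub>X = 0\<close> has unknown \<open>U = (V, \<Gamma>)\<close> and the flux below.
\<close>

definition p_system_flux :: "(real \<Rightarrow> real) \<Rightarrow> real ^ 2 \<Rightarrow> real ^ 2" where
  "p_system_flux P U = vector [- P (U $ 2), - (U $ 1)]"

definition kirchhoff_P :: "real \<Rightarrow> real \<Rightarrow> real \<Rightarrow> real \<Rightarrow> real" where
  "kirchhoff_P lam mu rho0 G =
     (1 / rho0) * (mu * (1 + G) ^ 3 - mu * (1 + G) + lam * (ln (1 + G) / (1 + G)))"

definition kirchhoff_threshold_eq :: "real \<Rightarrow> bool" where
  "kirchhoff_threshold_eq a \<longleftrightarrow>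
     6 * (5 + 4 * ln 6) * a =
       1 + 12 * a * ln (3 + 3 * sqrt (1 + 12 * a)) + sqrt (1 + 12 * a)"

end

theory Submission imports Defs begin

text \<open>
  With \<open>x = 1 + \<Gamma>\<close> and \<open>t = x\<^sup>2\<close>, positivity of \<open>P'\<close> reads
  \<open>3t\<^sup>2 - t + \<alpha> (1 - ln t / 2) > 0\<close>. The left side is minimal at the root \<open>y > 1/6\<close> of
  \<open>12y\<^sup>2 - 2y = \<alpha>\<close>, that is \<open>y = (1 + sqrt (1 + 12\<alpha>)) / 12\<close>, with minimum \<open>y h(y)\<close>, where
  \<open>h(y) = 15y - 3 - (6y - 1) ln y\<close>; in the variable \<open>y\<close> the threshold equation is \<open>h(y) = 0\<close>.
  The function \<open>h\<close> is strictly concave, negative at \<open>1/6\<close> and at \<open>exp 4\<close> and positive at \<open>1\<close>, so it has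
  exactly two zeros and is positive exactly between them.
\<close>

section \<open>The flux Jacobian and the derivative of the pressure law\<close>

lemma p_system_flux_has_derivative:
  assumes "(P has_real_derivative D) (at (U $ 2))"
  shows "(p_system_flux P has_derivative (\<lambda>H. vector [- (D * H $ 2), - (H $ 1)])) (at U)"
proof (subst has_derivative_componentwise_within, rule ballI)
  have nth2: "((\<lambda>V :: real ^ 2. V $ i) has_derivative (\<lambda>H. H $ i)) (at U)" for i
    by (rule bounded_linear_imp_has_derivative) (rule bounded_linear_vec_nth)
  have P: "((\<lambda>V :: real ^ 2. P (V $ 2)) has_derivative (\<lambda>H. D * H $ 2)) (at U)"
    using has_derivative_compose[OF nth2 assms[unfolded has_field_derivative_def]] .
  fix b :: "real ^ 2" assume "b \<in> Basis"
  then obtain i where b: "b = axis i 1"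
    by (auto simp: Basis_vec_def)
  consider "i = 1" | "i = 2"
    using exhaust_2 by blast
  then show "((\<lambda>V. p_system_flux P V \<bullet> b) has_derivative
      (\<lambda>H. vector [- (D * H $ 2), - (H $ 1)] \<bullet> b)) (at U)"
    by cases (use has_derivative_minus[OF P] has_derivative_minus[OF nth2[of 1]]
        in \<open>simp_all add: b p_system_flux_def inner_axis\<close>)
qed

text \<open>The Jacobian is antidiagonal with entries \<open>-D\<close> and \<open>-1\<close>, so
  its characteristic equation is \<open>c^2 = D\<close>; for \<open>D > 0\<close> this has two
  distinct real roots.\<close>

lemma p_system_strictly_hyperbolic:
  assumes "(P has_real_derivative D) (at (U $ 2))" and "D > 0"
  shows "strictly_hyperbolic_at (p_system_flux P) U"
proof -
  let ?F' = "\<lambda>H :: real ^ 2. vector [- (D * H $ 2), - (H $ 1)] :: real ^ 2"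
  note der = p_system_flux_has_derivative[OF assms(1)]
  \<comment> \<open>Uniqueness of the derivative gives the action of the Jacobian without computing
    its entries.\<close>
  have jac: "jacobian (p_system_flux P) (at U) *v v = ?F' v" for v
    using has_derivative_unique[OF jacobian_works[THEN iffD1, OF differentiableI[OF der]] der]
    by (rule fun_cong)
  have eig: "real_eigenvalues (jacobian (p_system_flux P) (at U)) = {sqrt D, - sqrt D}"
  proof (intro equalityI subsetI)
    fix c assume "c \<in> real_eigenvalues (jacobian (p_system_flux P) (at U))"
    then obtain v where v: "v \<noteq> 0" "?F' v = c *s v"
      by (auto simp: real_eigenvalues_def jac)
    have e: "- (D * v $ 2) = c * v $ 1" "- (v $ 1) = c * v $ 2"
      using arg_cong[OF v(2), of "\<lambda>w. w $ 1"] arg_cong[OF v(2), of "\<lambda>w. w $ 2"] by simp_all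
    have "v $ 2 \<noteq> 0"
      using v(1) e(2) by (auto simp: vec_eq_iff forall_2)
    moreover have "D * v $ 2 = c\<^sup>2 * v $ 2"
      using e(1) unfolding e(2)[unfolded minus_equation_iff[of "v $ 1"], symmetric]
      by (simp add: power2_eq_square)
    ultimately have "c\<^sup>2 = (sqrt D)\<^sup>2"
      using assms(2) by simp
    then show "c \<in> {sqrt D, - sqrt D}"
      by (simp add: power2_eq_iff)
  next
    fix c assume "c \<in> {sqrt D, - sqrt D}"
    then have "c * c = D"
      using assms(2) by auto
    \<comment> \<open>The eigenvector comes from the second component equation, normalised to have
      second entry 1.\<close>
    then have "?F' (vector [- c, 1]) = c *s vector [- c, 1]"
      by (simp add: vec_eq_iff forall_2)
    moreover have "vector [- c, 1] \<noteq> (0 :: real ^ 2)"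
      by (simp add: vec_eq_iff forall_2)
    ultimately show "c \<in> real_eigenvalues (jacobian (p_system_flux P) (at U))"
      by (auto simp: real_eigenvalues_def jac)
  qed
  have "sqrt D \<noteq> - sqrt D"
    using assms(2) real_sqrt_gt_zero[of D] by linarith
  then show ?thesis
    using der by (auto simp: strictly_hyperbolic_at_def eig differentiable_def)
qed

lemma kirchhoff_P_has_real_derivative:
  assumes "G > -1"
  shows "(kirchhoff_P lam mu rho0 has_real_derivative
    (1 / rho0) * (3 * mu * (1 + G)\<^sup>2 - mu + lam * ((1 - ln (1 + G)) / (1 + G)\<^sup>2))) (at G)"
  unfolding kirchhoff_P_def[abs_def]
proof (rule DERIV_cmult)
  show "((\<lambda>G. mu * (1 + G) ^ 3 - mu * (1 + G) + lam * (ln (1 + G) / (1 + G))) has_real_derivative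
      3 * mu * (1 + G)\<^sup>2 - mu + lam * ((1 - ln (1 + G)) / (1 + G)\<^sup>2)) (at G)"
    using assms by (auto intro!: derivative_eq_intros simp: power2_eq_square right_diff_distrib)
qed

section \<open>Concavity, zeros and sign of \<open>kirchhoff_h\<close>\<close>

definition kirchhoff_h :: "real \<Rightarrow> real" where
  "kirchhoff_h y = 15 * y - 3 - (6 * y - 1) * ln y"

lemma kirchhoff_h_has_real_derivative:
  assumes "y > 0"
  shows "(kirchhoff_h has_real_derivative 9 - 6 * ln y + 1 / y) (at y)"
  unfolding kirchhoff_h_def[abs_def]
  using assms by (auto intro!: derivative_eq_intros simp: field_simps)

text \<open>The derivative is strictly decreasing, so the mean value theorem on two adjacent
  intervals makes the left chord steeper in the signed sense. The slopes are compared with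
  denominators cleared.\<close>

lemma kirchhoff_h_strictly_concave:
  assumes "0 < a" "a < b" "b < c"
  shows "(kirchhoff_h c - kirchhoff_h b) * (b - a) < (kirchhoff_h b - kirchhoff_h a) * (c - b)"
proof -
  let ?d = "\<lambda>y :: real. 9 - 6 * ln y + 1 / y"
  obtain u where u: "a < u" "u < b" "kirchhoff_h b - kirchhoff_h a = (b - a) * ?d u"
    using MVT2[of a b kirchhoff_h ?d] assms kirchhoff_h_has_real_derivative by auto
  obtain v where v: "b < v" "v < c" "kirchhoff_h c - kirchhoff_h b = (c - b) * ?d v"
    using MVT2[of b c kirchhoff_h ?d] assms kirchhoff_h_has_real_derivative by auto
  have "ln u < ln v" "1 / v < 1 / u"
    using u v assms by (auto simp: frac_less2)
  then have "?d v < ?d u"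
    by linarith
  then have "(b - a) * (c - b) * ?d v < (b - a) * (c - b) * ?d u"
    using assms by simp
  then show ?thesis
    unfolding u(3) v(3) by (simp only: mult_ac)
qed

lemma kirchhoff_h_zeros:
  obtains y1 y2 where "1 / 6 < y1" "y1 < y2" "kirchhoff_h y1 = 0" "kirchhoff_h y2 = 0"
proof -
  have cont: "continuous_on {a..b} kirchhoff_h" if "a > 0" for a b
    using that by (intro continuous_at_imp_continuous_on ballI)
      (auto intro!: DERIV_isCont[OF kirchhoff_h_has_real_derivative])
  \<comment> \<open>The product with the logarithm vanishes at both points, leaving the values -1/2
    and 12.\<close>
  have neg: "kirchhoff_h (1 / 6) < 0" and pos: "kirchhoff_h 1 > 0"
    by (simp_all add: kirchhoff_h_def)
  have exp4: "(1 :: real) < exp 4"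
    by simp
  \<comment> \<open>With \<open>ln y = 4\<close> the value is \<open>1 - 9 * exp 4\<close>.\<close>
  have neg': "kirchhoff_h (exp 4) < 0"
    using exp4 unfolding kirchhoff_h_def ln_exp by argo
  obtain y1 where y1: "1 / 6 \<le> y1" "y1 \<le> 1" "kirchhoff_h y1 = 0"
    using IVT'[of kirchhoff_h "1 / 6" 0 1] neg pos cont by auto
  obtain y2 where y2: "1 \<le> y2" "y2 \<le> exp 4" "kirchhoff_h y2 = 0"
    using IVT2'[of kirchhoff_h "exp 4" 0 1] neg' pos cont exp4 by auto
  have "y1 \<noteq> 1 / 6" "y1 \<noteq> 1"
    using neg pos y1(3) by (metis less_irrefl)+
  then show ?thesis
    using that[of y1 y2] y1 y2 by simp
qed

text \<open>Each case applies the three-point inequality to \<open>y\<close> and the two zeros in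
  their order: a strictly concave function lies above its chord between the zeros and below the
  extended chord outside them.\<close>

lemma kirchhoff_h_sign:
  assumes "0 < y1" "y1 < y2" "kirchhoff_h y1 = 0" "kirchhoff_h y2 = 0" "0 < y"
  shows kirchhoff_h_pos_iff: "kirchhoff_h y > 0 \<longleftrightarrow> y1 < y \<and> y < y2"
    and kirchhoff_h_eq_0_iff: "kirchhoff_h y = 0 \<longleftrightarrow> y = y1 \<or> y = y2"
proof -
  have left: "kirchhoff_h y < 0" if "y < y1"
    using kirchhoff_h_strictly_concave[of y y1 y2] assms that by (simp add: mult_less_0_iff)
  have right: "kirchhoff_h y < 0" if "y2 < y"
    using kirchhoff_h_strictly_concave[of y1 y2 y] assms that by (simp add: mult_less_0_iff)
  have mid: "kirchhoff_h y > 0" if "y1 < y" "y < y2"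
  proof -
    have "0 < kirchhoff_h y * (y2 - y1)"
      using kirchhoff_h_strictly_concave[of y1 y y2] assms that by (simp add: algebra_simps)
    then show ?thesis
      using assms(2) by (simp add: zero_less_mult_iff)
  qed
  consider "y < y1" | "y = y1" | "y1 < y" "y < y2" | "y = y2" | "y2 < y"
    by linarith
  note cs = this
  show "kirchhoff_h y > 0 \<longleftrightarrow> y1 < y \<and> y < y2"
    using cs by cases (use left right mid assms in auto)
  show "kirchhoff_h y = 0 \<longleftrightarrow> y = y1 \<or> y = y2"
    using cs by cases (use left right mid assms in auto)
qed

section \<open>The change of variable from \<open>a\<close> to \<open>y\<close>\<close>

lemma kirchhoff_threshold_eq_iff:
  assumes "y > 1 / 6"
  shows "kirchhoff_threshold_eq (12 * y\<^sup>2 - 2 * y) \<longleftrightarrow> kirchhoff_h y = 0"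
proof -
  \<comment> \<open>The substitution makes the radicand a perfect square, and the argument of the
    logarithm becomes \<open>36 * y\<close>.\<close>
  have "1 + 12 * (12 * y\<^sup>2 - 2 * y) = (12 * y - 1)\<^sup>2"
    by (simp add: power2_eq_square algebra_simps)
  then have s: "sqrt (1 + 12 * (12 * y\<^sup>2 - 2 * y)) = 12 * y - 1"
    using assms by simp
  have "ln (36 * y) = ln (6 * 6 * y)"
    by simp
  also have "\<dots> = 2 * ln 6 + ln y"
    using assms by (simp only: ln_mult_pos)
  finally have l: "ln (3 + 3 * (12 * y - 1)) = 2 * ln 6 + ln y"
    by simp
  \<comment> \<open>The \<open>ln 6\<close> terms cancel, and the positive factor
    \<open>24 * y\<close> does not affect the zeros.\<close>
  have "6 * (5 + 4 * ln 6) * (12 * y\<^sup>2 - 2 * y) -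
      (1 + 12 * (12 * y\<^sup>2 - 2 * y) * (2 * ln 6 + ln y) + (12 * y - 1)) = 24 * y * kirchhoff_h y"
    by (simp add: kirchhoff_h_def power2_eq_square algebra_simps)
  then show ?thesis
    using assms unfolding kirchhoff_threshold_eq_def s l by auto
qed

lemma quadratic_parametrisation:
  fixes a :: real
  assumes "a > 0"
  obtains y where "y > 1 / 6" "a = 12 * y\<^sup>2 - 2 * y"
proof
  let ?s = "sqrt (1 + 12 * a)"
  have "1 < ?s"
    using assms by simp
  then show "1 / 6 < (1 + ?s) / 12"
    by simp
  have "?s\<^sup>2 = 1 + 12 * a"
    using assms by simp
  then show "a = 12 * ((1 + ?s) / 12)\<^sup>2 - 2 * ((1 + ?s) / 12)"
    by (simp add: power2_eq_square field_simps)
qed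

text \<open>Monotonicity of the substitution carries the bounds on \<open>lam / mu\<close> over to
  bounds on \<open>y\<close>.\<close>

lemma quadratic_less_iff:
  fixes y z :: real
  assumes "y > 1 / 6" "z > 1 / 6"
  shows "12 * y\<^sup>2 - 2 * y < 12 * z\<^sup>2 - 2 * z \<longleftrightarrow> y < z"
proof -
  have "12 * z\<^sup>2 - 2 * z - (12 * y\<^sup>2 - 2 * y) = (z - y) * (12 * (z + y) - 2)"
    by (simp add: power2_eq_square algebra_simps)
  moreover have "12 * (z + y) - 2 > 0"
    using assms by simp
  ultimately show ?thesis
    by (smt (verit) zero_less_mult_iff)
qed

text \<open>The tangent bound \<open>ln t \<le> ln y + t/y - 1\<close> turns the left side into at least \<open>3(t - y)\<^sup>2 + y h(y)\<close>.\<close>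

lemma kirchhoff_quadratic_log_pos:
  assumes "y > 1 / 6" "kirchhoff_h y > 0" "t > 0"
  shows "3 * t\<^sup>2 - t + (12 * y\<^sup>2 - 2 * y) * (1 - ln t / 2) > 0"
proof -
  have "ln (t / y) \<le> t / y - 1"
    using assms by (intro ln_le_minus_one) simp
  then have "ln t \<le> ln y + t / y - 1"
    using assms by (simp add: ln_div)
  \<comment> \<open>The factor is half of \<open>12 * y^2 - 2 * y\<close>, the coefficient of
    \<open>ln t\<close> in the goal up to sign; it is positive since \<open>y > 1/6\<close>.\<close>
  then have "y * (6 * y - 1) * ln t \<le> y * (6 * y - 1) * (ln y + t / y - 1)"
    using assms by (intro mult_left_mono) simp_all
  also have "\<dots> = y * (6 * y - 1) * (ln y - 1) + (6 * y - 1) * t"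
    using assms by (simp add: field_simps)
  finally have *: "y * (6 * y - 1) * ln t \<le> y * (6 * y - 1) * (ln y - 1) + (6 * y - 1) * t" .
  have "0 < 3 * (t - y)\<^sup>2 + y * kirchhoff_h y"
    using assms by (intro add_nonneg_pos) simp_all
  also have "\<dots> = 3 * t\<^sup>2 - t + (12 * y\<^sup>2 - 2 * y) -
      (y * (6 * y - 1) * (ln y - 1) + (6 * y - 1) * t)"
    by (simp add: kirchhoff_h_def power2_eq_square algebra_simps)
  also have "\<dots> \<le> 3 * t\<^sup>2 - t + (12 * y\<^sup>2 - 2 * y) - y * (6 * y - 1) * ln t"
    using * by linarith
  also have "\<dots> = 3 * t\<^sup>2 - t + (12 * y\<^sup>2 - 2 * y) * (1 - ln t / 2)"
    by (simp add: power2_eq_square algebra_simps)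
  finally show ?thesis .
qed

text \<open>With \<open>x = 1 + G\<close> and \<open>t = x^2\<close>, the derivative is the
  expression just bounded times the positive factor \<open>mu / (rho0 * x^2)\<close>.\<close>

lemma kirchhoff_P_derivative_pos:
  assumes "mu > 0" "rho0 > 0" "y > 1 / 6" "lam / mu = 12 * y\<^sup>2 - 2 * y" "kirchhoff_h y > 0" "G > -1"
  shows "(1 / rho0) * (3 * mu * (1 + G)\<^sup>2 - mu + lam * ((1 - ln (1 + G)) / (1 + G)\<^sup>2)) > 0"
proof -
  define x where "x = 1 + G"
  have x: "x > 0"
    using assms by (simp add: x_def)
  have lam: "lam = mu * (12 * y\<^sup>2 - 2 * y)"
    using assms by (simp add: field_simps)
  have "0 < 3 * (x\<^sup>2)\<^sup>2 - x\<^sup>2 + (12 * y\<^sup>2 - 2 * y) * (1 - ln (x\<^sup>2) / 2)"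
    using assms x by (intro kirchhoff_quadratic_log_pos) simp_all
  also have "ln (x\<^sup>2) / 2 = ln x"
    using x by (simp add: ln_realpow)
  finally have "0 < mu / (rho0 * x\<^sup>2) * (3 * (x\<^sup>2)\<^sup>2 - x\<^sup>2 + (12 * y\<^sup>2 - 2 * y) * (1 - ln x))"
    using assms x by simp
  also have "\<dots> = (1 / rho0) * (3 * mu * x\<^sup>2 - mu + lam * ((1 - ln x) / x\<^sup>2))"
    using assms x unfolding lam by (simp add: field_simps power2_eq_square)
  finally show ?thesis
    by (simp add: x_def)
qed

theorem mainTheorem4:
  "\<exists>\<alpha>\<^sub>1 \<alpha>\<^sub>2 :: real.
     0 < \<alpha>\<^sub>1 \<and> \<alpha>\<^sub>1 < \<alpha>\<^sub>2 \<and>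
     {a. a > 0 \<and> kirchhoff_threshold_eq a} = {\<alpha>\<^sub>1, \<alpha>\<^sub>2} \<and>
     (\<forall>lam mu rho0 :: real. lam > 0 \<and> mu > 0 \<and> rho0 > 0 \<and>
        \<alpha>\<^sub>1 < lam / mu \<and> lam / mu < \<alpha>\<^sub>2 \<longrightarrow>
        (\<forall>G > -1. deriv (kirchhoff_P lam mu rho0) G > 0) \<and>
        (\<forall>V G. G > -1 \<longrightarrow>
           strictly_hyperbolic_at (p_system_flux (kirchhoff_P lam mu rho0)) (vector [V, G])))"
proof -
  let ?q = "\<lambda>y :: real. 12 * y\<^sup>2 - 2 * y"
  obtain y1 y2 where y: "1 / 6 < y1" "y1 < y2" "kirchhoff_h y1 = 0" "kirchhoff_h y2 = 0"
    by (rule kirchhoff_h_zeros)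
  have y': "0 < y1" "1 / 6 < y2"
    using y by simp_all
  have q_pos: "?q z > 0" if "z > 1 / 6" for z
  proof -
    have "?q z = 2 * z * (6 * z - 1)"
      by (simp add: power2_eq_square algebra_simps)
    then show ?thesis
      using that by simp
  qed
  \<comment> \<open>Every positive \<open>a\<close> is \<open>?q z\<close> for some
    \<open>z > 1/6\<close>, so the positive roots are exactly the images of the two zeros of
    \<open>kirchhoff_h\<close>.\<close>
  have roots: "{a. a > 0 \<and> kirchhoff_threshold_eq a} = {?q y1, ?q y2}"
  proof (intro equalityI subsetI)
    fix a assume "a \<in> {a. a > 0 \<and> kirchhoff_threshold_eq a}"
    then have a: "a > 0" "kirchhoff_threshold_eq a"
      by simp_all
    obtain z where z: "z > 1 / 6" "a = ?q z"
      using quadratic_parametrisation[OF a(1)] .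
    then have "kirchhoff_h z = 0"
      using a(2) kirchhoff_threshold_eq_iff by simp
    then have "z = y1 \<or> z = y2"
      using kirchhoff_h_eq_0_iff[OF y'(1) y(2-4), of z] z(1) by simp
    then show "a \<in> {?q y1, ?q y2}"
      using z(2) by blast
  next
    fix a assume "a \<in> {?q y1, ?q y2}"
    then show "a \<in> {a. a > 0 \<and> kirchhoff_threshold_eq a}"
      using q_pos y y' kirchhoff_threshold_eq_iff by auto
  qed
  have "deriv (kirchhoff_P lam mu rho0) G > 0 \<and>
      strictly_hyperbolic_at (p_system_flux (kirchhoff_P lam mu rho0)) (vector [V, G])"
    if A: "lam > 0" "mu > 0" "rho0 > 0" "?q y1 < lam / mu" "lam / mu < ?q y2" "G > -1"
    for lam mu rho0 V G
  proof -
    obtain z where z: "z > 1 / 6" "lam / mu = ?q z"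
      using quadratic_parametrisation[of "lam / mu"] A by auto
    then have "y1 < z" "z < y2"
      using A(4,5) quadratic_less_iff y(1) y'(2) by simp_all
    then have "kirchhoff_h z > 0"
      using kirchhoff_h_pos_iff[OF y'(1) y(2-4), of z] z(1) by simp
    note pos = kirchhoff_P_derivative_pos[OF A(2,3) z this A(6)]
    note der = kirchhoff_P_has_real_derivative[OF A(6), of lam mu rho0]
    show ?thesis
      using pos DERIV_imp_deriv[OF der]
        p_system_strictly_hyperbolic[of "kirchhoff_P lam mu rho0" _ "vector [V, G]"] der
      by simp
  qed
  moreover have "0 < ?q y1" "?q y1 < ?q y2"
    using q_pos[OF y(1)] quadratic_less_iff[OF y(1) y'(2)] y(2) by simp_all
  ultimately show ?thesis
    using roots by (intro exI[of _ "?q y1"] exI[of _ "?q y2"] conjI allI impI) simp_all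
qed

end
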